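(* Let $X$ be a compact topological space, $Y$ a topological space, $c:X\times Y\to\mathbb{R}$ a coupling that is uniformly arc-wise convex with respect to the second variable, and $B:X\to Y$ a $c$-skew symmetric map. Let $\phi:X\to\mathbb{R}$ be a lower semi-continuous function such that the map $(x,y)\mapsto\phi(x)-c(x,y)$ is uniformly arc-wise convex in the first variable, and set $$J(x)=\phi(x)+\phi^c(Bx)-c(x,Bx),\qquad x\in X.$$ Then: 1. $\inf_{x\in X}J(x)=0$. 2. If $B$ and $c$ are continuous, then the infimum is attained at some $x_0\in X$ such that $Bx_0\in\partial_c\phi(x_0)$.
   Context: $B:X\to Y$ is $c$-skew symmetric (also called $c$-skew adjoint) if $c(x_1,Bx_1)+c(x_2,Bx_2)=c(x_1,Bx_2)+c(x_2,Bx_1)$ for all $x_1,x_2\in X$. $\phi^c(y)=\sup_{x\in X}\{c(x,y)-\phi(x)\}$ and $\partial_c\phi(x_0)=\{y_0\in Y;\ \phi(x_0)-\phi(x)\le c(x_0,y_0)-c(x,y_0)\ \forall x\in X\}$. A function $F:X\times Y\to\mathbb{R}$ is uniformly arc-wise convex with respect to the second variable if for each $y_0,y_1\in Y$ there exists a continuous curve $\zeta:[0,1]\to Y$ with $\zeta(0)=y_0$, $\zeta(1)=y_1$ such that $F(x,\zeta(t))\le(1-t)F(x,y_0)+tF(x,y_1)$ for all $t\in[0,1]$ and all $x\in X$. Uniform arc-wise convexity with respect to the first variable is defined in the same way with the roles of the variables exchanged: for each $x_0,x_1\in X$ there is a continuous curve $\zeta:[0,1]\to X$ from $x_0$ to $x_1$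 with $F(\zeta(t),y)\le(1-t)F(x_0,y)+tF(x_1,y)$ for all $t\in[0,1]$, $y\in Y$.
   Formalization: Part 1 is stated under the added assumption that c(·,y) is upper semi-continuous on X for every y; without it part 1 is false (X=[0,1], Y=ℝ, φ=0, c(x,y)=g(x)−y, B=g, g(0)=0, g(x)=1/x for x>0 gives J≡+∞). *)

theory Defs
  imports "HOL-Analysis.Analysis"
begin

definition lower_semicont :: "('a::topological_space \<Rightarrow> real) \<Rightarrow> bool" where
  "lower_semicont f \<longleftrightarrow> (\<forall>a. open {x. a < f x})"

(* Upper semicontinuity of c in its first variable is needed for inf J = 0.  Without it, the
   claim fails for X = [0,1], Y = R, phi = 0, c (x, y) = g x - y and B = g, where g 0 = 0 and
   g x = 1/x otherwise: there J is constantly infinite. *)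
definition upper_semicont :: "('a::topological_space \<Rightarrow> real) \<Rightarrow> bool" where
  "upper_semicont f \<longleftrightarrow> (\<forall>a. open {x. f x < a})"

(* "Uniformly": the curve depends only on the two end points, not on the other variable. *)

definition unif_arcwise_convex_fst :: "('a::topological_space \<times> 'b \<Rightarrow> real) \<Rightarrow> bool" where
  "unif_arcwise_convex_fst F \<longleftrightarrow>
     (\<forall>x0 x1. \<exists>\<zeta>. path \<zeta> \<and> pathstart \<zeta> = x0 \<and> pathfinish \<zeta> = x1 \<and>
        (\<forall>t\<in>{0..1}. \<forall>y. F (\<zeta> t, y) \<le> (1 - t) * F (x0, y) + t * F (x1, y)))"

definition unif_arcwise_convex_snd :: "('a \<times> 'b::topological_space \<Rightarrow> real) \<Rightarrow> bool" where
  "unif_arcwise_convex_snd F \<longleftrightarrow>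
     (\<forall>y0 y1. \<exists>\<zeta>. path \<zeta> \<and> pathstart \<zeta> = y0 \<and> pathfinish \<zeta> = y1 \<and>
        (\<forall>t\<in>{0..1}. \<forall>x. F (x, \<zeta> t) \<le> (1 - t) * F (x, y0) + t * F (x, y1)))"

definition c_skew_symmetric :: "('a \<times> 'b \<Rightarrow> real) \<Rightarrow> ('a \<Rightarrow> 'b) \<Rightarrow> bool" where
  "c_skew_symmetric c B \<longleftrightarrow>
     (\<forall>x1 x2. c (x1, B x1) + c (x2, B x2) = c (x1, B x2) + c (x2, B x1))"

(* The supremum may be infinite, hence the values in ereal. *)
definition c_conjugate :: "('a \<times> 'b \<Rightarrow> real) \<Rightarrow> ('a \<Rightarrow> real) \<Rightarrow> 'b \<Rightarrow> ereal" where
  "c_conjugate c \<phi> y = (SUP x. ereal (c (x, y) - \<phi> x))"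

definition c_subdifferential :: "('a \<times> 'b \<Rightarrow> real) \<Rightarrow> ('a \<Rightarrow> real) \<Rightarrow> 'a \<Rightarrow> 'b set" where
  "c_subdifferential c \<phi> x0 = {y0. \<forall>x. \<phi> x0 - \<phi> x \<le> c (x0, y0) - c (x, y0)}"

definition J_functional ::
    "('a \<times> 'b \<Rightarrow> real) \<Rightarrow> ('a \<Rightarrow> 'b) \<Rightarrow> ('a \<Rightarrow> real) \<Rightarrow> 'a \<Rightarrow> ereal" where
  "J_functional c B \<phi> x = ereal (\<phi> x) + c_conjugate c \<phi> (B x) - ereal (c (x, B x))"

end

theory Submission
  imports Defs
begin

text \<open>
  By skew symmetry, \<open>J x\<close> is the supremum over \<open>z\<close> of the payoff
  \<open>M x z = (\<phi> x - c (x, B z)) - (\<phi> z - c (z, B z))\<close>, and \<open>M\<close> is antisymmetric, so it is the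
  payoff of a symmetric game, and \<open>J \<ge> 0\<close> because \<open>M x x = 0\<close>. Since \<open>M\<close> is convex-like and
  lower semicontinuous in \<open>x\<close>, the game has a strategy \<open>x0\<close> with \<open>M x0 z \<le> 0\<close> for all \<open>z\<close>:
  against finitely many \<open>z\<close> an approximate one is found by Blackwell's approachability
  iteration, and compactness does the rest. Such an \<open>x0\<close> satisfies \<open>J x0 = 0\<close>.
\<close>

section \<open>Symmetric games with convex-like payoff\<close>

text \<open>Induction on \<open>S\<close> merges one point at a time by the two-point hypothesis.
  The weights stay unnormalised, so the induction hypothesis applies to \<open>S\<close> without
  rescaling.\<close>

lemma convexlike_combination:
  fixes M :: "'a \<Rightarrow> 'b \<Rightarrow> real"
  assumes conv: "\<And>x0 x1 t. t \<in> {0..1} \<Longrightarrow> \<exists>w. \<forall>z. M w z \<le> (1 - t) * M x0 z + t * M x1 z"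
    and "finite S" and "\<And>i. i \<in> S \<Longrightarrow> 0 \<le> \<nu> i"
  shows "\<exists>w. \<forall>z. sum \<nu> S * M w z \<le> (\<Sum>i\<in>S. \<nu> i * M (p i) z)"
  using assms(2,3)
proof (induction S rule: finite_induct)
  case (insert a S)
  then obtain w where w: "\<And>z. sum \<nu> S * M w z \<le> (\<Sum>i\<in>S. \<nu> i * M (p i) z)"
    by auto
  have nonneg: "0 \<le> \<nu> a" "0 \<le> sum \<nu> S"
    using insert.prems by (auto intro: sum_nonneg)
  define T where "T = \<nu> a + sum \<nu> S"
  show ?case
  proof (cases "T = 0")
    case True
    then have "\<nu> a = 0" "sum \<nu> S = 0"
      using nonneg by (auto simp: T_def)
    then show ?thesis
      using insert.hyps w by auto
  next
    case False
    then have "T > 0"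
      using nonneg by (auto simp: T_def)
    then have "\<nu> a / T \<in> {0..1}"
      using nonneg by (auto simp: T_def)
    \<comment> \<open>\<open>w\<close> stands for all of \<open>S\<close> with mass
      \<open>sum \<nu> S\<close>, so the new point \<open>p a\<close> gets the share
      \<open>\<nu> a / T\<close> of the total mass.\<close>
    from conv[OF this, of w "p a"] obtain u
      where u: "\<And>z. M u z \<le> (1 - \<nu> a / T) * M w z + \<nu> a / T * M (p a) z"
      by auto
    have "T * M u z \<le> \<nu> a * M (p a) z + (\<Sum>i\<in>S. \<nu> i * M (p i) z)" for z
    proof -
      have "T * M u z \<le> T * ((1 - \<nu> a / T) * M w z + \<nu> a / T * M (p a) z)"
        using u \<open>T > 0\<close> by (intro mult_left_mono) auto
      also have "\<dots> = sum \<nu> S * M w z + \<nu> a * M (p a) z"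
      proof -
        have "T * (1 - \<nu> a / T) = sum \<nu> S" "T * (\<nu> a / T) = \<nu> a"
          using \<open>T > 0\<close> by (auto simp: T_def field_simps)
        then show ?thesis
          by (metis distrib_left mult.assoc)
      qed
      finally show ?thesis
        using w[of z] by simp
    qed
    then show ?thesis
      using insert.hyps by (auto simp: T_def)
  qed
qed simp

text \<open>The sum is the squared distance of the payoff vector of \<open>x\<close> on
  \<open>S\<close> from the nonpositive orthant. Its positive part \<open>v\<close>, normalised,
  serves as a mixed strategy whose payoff vector \<open>b\<close> is orthogonal to \<open>v\<close>
  by antisymmetry. Moving from \<open>x\<close> a fraction \<open>t\<close> towards that strategy
  thus leaves no cross term.\<close>

lemma blackwell_step:
  fixes M :: "'a \<Rightarrow> 'a \<Rightarrow> real"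
  assumes antisym: "\<And>x z. M x z = - M z x"
    and conv: "\<And>x0 x1 t. t \<in> {0..1} \<Longrightarrow> \<exists>w. \<forall>z. M w z \<le> (1 - t) * M x0 z + t * M x1 z"
    and "finite S" and bound: "\<And>i j. i \<in> S \<Longrightarrow> j \<in> S \<Longrightarrow> \<bar>M i j\<bar> \<le> K"
    and t: "t \<in> {0..1}"
  shows "\<exists>y. (\<Sum>j\<in>S. (max 0 (M y j))\<^sup>2)
           \<le> (1 - t)\<^sup>2 * (\<Sum>j\<in>S. (max 0 (M x j))\<^sup>2) + t\<^sup>2 * (real (card S) * K\<^sup>2)"
proof -
  define v where "v j = max 0 (M x j)" for j
  define V where "V = sum v S"
  have v0: "0 \<le> v j" for j
    by (simp add: v_def)
  show ?thesis
  proof (cases "V = 0")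
    case True
    then have "v j = 0" if "j \<in> S" for j
      using that v0 \<open>finite S\<close> by (simp add: V_def sum_nonneg_eq_0_iff)
    then have "(\<Sum>j\<in>S. (max 0 (M x j))\<^sup>2) = 0"
      by (simp add: v_def)
    then show ?thesis
      by (intro exI[of _ x]) simp
  next
    case False
    then have "V > 0"
      using v0 by (simp add: V_def less_le sum_nonneg)
    \<comment> \<open>The payoff against \<open>j\<close> when \<open>i\<close> is played with
      probability \<open>v i / V\<close>; by convexity the single point \<open>w\<close> does at
      least as well.\<close>
    define b where "b j = (\<Sum>i\<in>S. v i * M i j) / V" for j
    obtain w where w: "\<And>z. V * M w z \<le> (\<Sum>i\<in>S. v i * M i z)"
      using convexlike_combination[of M S v "\<lambda>i. i"] conv \<open>finite S\<close> v0
      by (auto simp: V_def)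
    have wb: "M w j \<le> b j" for j
      using w[of j] \<open>V > 0\<close> by (simp add: b_def field_simps)
    have bK: "(b j)\<^sup>2 \<le> K\<^sup>2" if "j \<in> S" for j
    proof -
      have "\<bar>\<Sum>i\<in>S. v i * M i j\<bar> \<le> (\<Sum>i\<in>S. v i * K)"
        using bound that v0
        by (intro order_trans[OF sum_abs] sum_mono) (auto simp: abs_mult intro: mult_left_mono)
      also have "\<dots> = K * V"
        by (simp add: V_def sum_distrib_left mult.commute)
      finally have "\<bar>b j\<bar> \<le> K"
        using \<open>V > 0\<close> by (simp add: b_def pos_divide_le_eq)
      then show ?thesis
        by (metis abs_ge_zero power2_abs power_mono)
    qed
    \<comment> \<open>Up to the factor \<open>V\<close> this is the quadratic form of an
      antisymmetric matrix: swapping the indices gives \<open>Q = - Q\<close>.\<close>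
    have orth: "(\<Sum>j\<in>S. v j * b j) = 0"
    proof -
      define Q where "Q = (\<Sum>j\<in>S. \<Sum>i\<in>S. v j * v i * M i j)"
      have "Q = (\<Sum>j\<in>S. \<Sum>i\<in>S. v j * v i * - M j i)"
        unfolding Q_def by (subst antisym) simp
      also have "\<dots> = - (\<Sum>j\<in>S. \<Sum>i\<in>S. v i * v j * M j i)"
        by (simp add: sum_negf mult_ac)
      also have "(\<Sum>j\<in>S. \<Sum>i\<in>S. v i * v j * M j i) = Q"
        unfolding Q_def by (rule sum.swap)
      finally have "Q = 0"
        by simp
      moreover have "(\<Sum>j\<in>S. v j * b j) = Q / V"
        by (simp add: b_def Q_def sum_distrib_left sum_divide_distrib mult_ac)
      ultimately show ?thesis
        by simp
    qed
    obtain y where y: "\<And>z. M y z \<le> (1 - t) * M x z + t * M w z"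
      using conv[OF t, of x w] by auto
    \<comment> \<open>The bound on \<open>M y j\<close> may be squared only where
      \<open>M y j\<close> is positive; elsewhere the left side is 0 and the right side is a
      square.\<close>
    have step: "(max 0 (M y j))\<^sup>2 \<le> ((1 - t) * v j + t * b j)\<^sup>2" for j
    proof (cases "M y j \<le> 0")
      case False
      have "M y j \<le> (1 - t) * v j + t * b j"
        using t wb by (intro order_trans[OF y] add_mono mult_left_mono) (auto simp: v_def)
      then show ?thesis
        using False by (simp add: power_mono)
    qed simp
    have "(\<Sum>j\<in>S. (max 0 (M y j))\<^sup>2) \<le> (\<Sum>j\<in>S. ((1 - t) * v j + t * b j)\<^sup>2)"
      by (intro sum_mono step)
    also have "\<dots> = (\<Sum>j\<in>S. (1 - t)\<^sup>2 * (v j)\<^sup>2 + 2 * (1 - t) * t * (v j * b j) + t\<^sup>2 * (b j)\<^sup>2)"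
      by (intro sum.cong) (auto simp: power2_eq_square algebra_simps)
    also have "\<dots> = (1 - t)\<^sup>2 * (\<Sum>j\<in>S. (v j)\<^sup>2) + t\<^sup>2 * (\<Sum>j\<in>S. (b j)\<^sup>2)"
      using orth by (simp add: sum.distrib sum_distrib_left[symmetric])
    also have "\<dots> \<le> (1 - t)\<^sup>2 * (\<Sum>j\<in>S. (v j)\<^sup>2) + t\<^sup>2 * (real (card S) * K\<^sup>2)"
      using sum_bounded_above[of S "\<lambda>j. (b j)\<^sup>2" "K\<^sup>2"] bK
      by (intro add_left_mono mult_left_mono) auto
    finally show ?thesis
      by (auto simp: v_def)
  qed
qed

text \<open>Iterating the Blackwell step with step sizes 1, 1/2, 1/3, ... drives the squared
  distance \<open>F\<close> to 0 at rate \<open>C / k\<close>.\<close>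

lemma symmetric_game_finite_approx:
  fixes M :: "'a \<Rightarrow> 'a \<Rightarrow> real"
  assumes antisym: "\<And>x z. M x z = - M z x"
    and conv: "\<And>x0 x1 t. t \<in> {0..1} \<Longrightarrow> \<exists>w. \<forall>z. M w z \<le> (1 - t) * M x0 z + t * M x1 z"
    and S: "finite S" and "\<epsilon> > 0"
  shows "\<exists>x. \<forall>z\<in>S. M x z \<le> \<epsilon>"
proof -
  define K where "K = (\<Sum>i\<in>S. \<Sum>j\<in>S. \<bar>M i j\<bar>)"
  have bound: "\<bar>M i j\<bar> \<le> K" if "i \<in> S" "j \<in> S" for i j
  proof -
    have "\<bar>M i j\<bar> \<le> (\<Sum>j\<in>S. \<bar>M i j\<bar>)"
      using that S by (intro member_le_sum) auto
    also have "\<dots> \<le> K"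
      unfolding K_def using that S
      by (intro member_le_sum[where f = "\<lambda>i. \<Sum>j\<in>S. \<bar>M i j\<bar>"]) (auto intro: sum_nonneg)
    finally show ?thesis .
  qed
  define C where "C = real (card S) * K\<^sup>2"
  define F where "F x = (\<Sum>j\<in>S. (max 0 (M x j))\<^sup>2)" for x
  have step: "\<exists>y. F y \<le> (1 - t)\<^sup>2 * F x + t\<^sup>2 * C" if "t \<in> {0..1}" for t x
    unfolding F_def C_def using blackwell_step[OF antisym conv S bound that] by blast
  have decay: "\<exists>x. F x \<le> C / real (Suc k)" for k
  proof (induction k)
    case 0
    show ?case
      \<comment> \<open>With \<open>t = 1\<close> the starting point drops out of the bound, so any
        point will do.\<close>
      using step[of 1 undefined] by simp
  next
    case (Suc k)
    then obtain x where x: "F x \<le> C / real (Suc k)"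
      by auto
    \<comment> \<open>This \<open>t\<close> minimises
      \<open>(1 - t)\<^sup>2 * (C / r) + t\<^sup>2 * C\<close> for \<open>r = k + 1\<close>; the
      minimum is \<open>C / (r + 1)\<close>.\<close>
    define t where "t = 1 / real (Suc (Suc k))"
    obtain y where "F y \<le> (1 - t)\<^sup>2 * F x + t\<^sup>2 * C"
      using step[of t x] by (auto simp: t_def)
    also have "\<dots> \<le> (1 - t)\<^sup>2 * (C / real (Suc k)) + t\<^sup>2 * C"
      using x by (intro add_right_mono mult_left_mono) auto
    also have "\<dots> = C / real (Suc (Suc k))"
    proof -
      define r where "r = real (Suc k)"
      have "r > 0" and t: "1 - t = r * t" "t + r * t = 1"
        by (simp_all add: r_def t_def divide_simps)
      from \<open>r > 0\<close> have "r\<^sup>2 / r = r"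
        by (simp add: power2_eq_square)
      have "(1 - t)\<^sup>2 * (C / r) + t\<^sup>2 * C = (r\<^sup>2 / r) * (C * t\<^sup>2) + C * t\<^sup>2"
        unfolding t(1) by (simp add: power_mult_distrib mult_ac)
      also have "\<dots> = C * t * (t + r * t)"
        unfolding \<open>r\<^sup>2 / r = r\<close> by (simp add: power2_eq_square distrib_left mult_ac)
      also have "\<dots> = C / real (Suc (Suc k))"
        unfolding t(2) by (simp add: t_def)
      finally show ?thesis
        by (simp only: r_def)
    qed
    finally show ?case
      by auto
  qed
  obtain k where "C / \<epsilon>\<^sup>2 < real k"
    using reals_Archimedean2 by blast
  then have "C / real (Suc k) < \<epsilon>\<^sup>2"
    using \<open>\<epsilon> > 0\<close> by (simp add: field_simps) (smt (verit) zero_less_power)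
  moreover obtain x where "F x \<le> C / real (Suc k)"
    using decay by blast
  ultimately have "F x < \<epsilon>\<^sup>2"
    by simp
  have "M x z \<le> \<epsilon>" if "z \<in> S" for z
  proof -
    have "(max 0 (M x z))\<^sup>2 \<le> F x"
      unfolding F_def using that S by (intro member_le_sum) auto
    then have "max 0 (M x z) < \<epsilon>"
      using \<open>F x < \<epsilon>\<^sup>2\<close> \<open>\<epsilon> > 0\<close> by (intro power2_less_imp_less[of _ \<epsilon>]) auto
    then show ?thesis
      by simp
  qed
  then show ?thesis
    by blast
qed

text \<open>The sublevel sets \<open>L (z, e)\<close> with \<open>e > 0\<close> are closed by lower
  semicontinuity and have the finite intersection property by the approximate solutions. Compactness
  gives a common point, and then \<open>e\<close> tends to 0.\<close>

lemma symmetric_game_solution: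
  fixes M :: "'a::topological_space \<Rightarrow> 'a \<Rightarrow> real"
  assumes compact: "compact (UNIV :: 'a set)"
    and lsc: "\<And>z. lower_semicont (\<lambda>x. M x z)"
    and antisym: "\<And>x z. M x z = - M z x"
    and conv: "\<And>x0 x1 t. t \<in> {0..1} \<Longrightarrow> \<exists>w. \<forall>z. M w z \<le> (1 - t) * M x0 z + t * M x1 z"
  shows "\<exists>x. \<forall>z. M x z \<le> 0"
proof -
  define L where "L p = {x. M x (fst p) \<le> snd p}" for p
  have "UNIV \<inter> (\<Inter>p\<in>UNIV \<times> {0<..}. L p) \<noteq> {}"
  proof (rule compact_imp_fip_image[OF compact])
    show "closed (L p)" for p
    proof -
      have "- L p = {x. snd p < M x (fst p)}"
        by (auto simp: L_def)
      then show ?thesis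
        using lsc unfolding closed_def lower_semicont_def by metis
    qed
    fix I :: "('a \<times> real) set"
    assume I: "finite I" "I \<subseteq> UNIV \<times> {0<..}"
    \<comment> \<open>One tolerance below all those in \<open>I\<close>; the 1 keeps the set
      nonempty when \<open>I\<close> is empty.\<close>
    define \<epsilon> where "\<epsilon> = Min (insert 1 (snd ` I))"
    have "\<epsilon> > 0" and le: "\<And>p. p \<in> I \<Longrightarrow> \<epsilon> \<le> snd p"
      using I by (auto simp: \<epsilon>_def)
    obtain x where x: "\<forall>z\<in>fst ` I. M x z \<le> \<epsilon>"
      using symmetric_game_finite_approx[OF antisym conv _ \<open>\<epsilon> > 0\<close>, of "fst ` I"] I by auto
    have "x \<in> L p" if "p \<in> I" for p
      using x le[OF that] that by (force simp: L_def)
    then show "UNIV \<inter> (\<Inter>p\<in>I. L p) \<noteq> {}"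
      by blast
  qed
  then obtain x where x: "\<forall>z. \<forall>e\<in>{0<..}. M x z \<le> e"
    by (auto simp: L_def)
  have "M x z \<le> 0" for z
    using x by (simp add: field_le_epsilon)
  then show ?thesis
    by blast
qed

section \<open>From the game to the functional J\<close>

lemma J_functional_nonneg: "0 \<le> J_functional c B \<phi> x"
proof -
  have "ereal (c (x, B x) - \<phi> x) \<le> c_conjugate c \<phi> (B x)"
    unfolding c_conjugate_def by (rule SUP_upper) simp
  then show ?thesis
    unfolding J_functional_def by (cases "c_conjugate c \<phi> (B x)") (auto simp: zero_ereal_def)
qed

text \<open>A subgradient \<open>B x\<close> at \<open>x\<close> makes \<open>x\<close> itself a
  maximiser in the supremum defining the conjugate at \<open>B x\<close>.\<close>

lemma J_functional_le_0:
  assumes "B x \<in> c_subdifferential c \<phi> x"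
  shows "J_functional c B \<phi> x \<le> 0"
proof -
  have "c (z, B x) - \<phi> z \<le> c (x, B x) - \<phi> x" for z
    using assms by (simp add: c_subdifferential_def algebra_simps)
  then have "c_conjugate c \<phi> (B x) \<le> ereal (c (x, B x) - \<phi> x)"
    unfolding c_conjugate_def by (intro SUP_least) simp
  then show ?thesis
    unfolding J_functional_def by (cases "c_conjugate c \<phi> (B x)") (auto simp: zero_ereal_def)
qed

lemma lower_semicont_diff:
  assumes "lower_semicont f" and "upper_semicont g"
  shows "lower_semicont (\<lambda>x. f x - g x)"
  unfolding lower_semicont_def
proof
  fix a
  \<comment> \<open>A number \<open>r\<close> strictly between \<open>a + g x\<close> and
    \<open>f x\<close> decouples the conditions on \<open>f\<close> and \<open>g\<close>.\<close>
  have "{x. a < f x - g x} = (\<Union>r. {x. r < f x} \<inter> {x. g x < r - a})"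
  proof (intro set_eqI iffI)
    fix x assume "x \<in> {x. a < f x - g x}"
    then have "a + g x < f x"
      by simp
    then obtain r where "a + g x < r" "r < f x"
      using dense by blast
    then show "x \<in> (\<Union>r. {x. r < f x} \<inter> {x. g x < r - a})"
      by (auto intro!: exI[of _ r])
  qed auto
  moreover have "open (\<Union>r. {x. r < f x} \<inter> {x. g x < r - a})"
    using assms unfolding lower_semicont_def upper_semicont_def
    by (intro open_UN ballI open_Int) blast+
  ultimately show "open {x. a < f x - g x}"
    by simp
qed

text \<open>Skew symmetry rewrites \<open>M x z\<close> as
  \<open>\<phi> x - \<phi> z - (c (x, B x) - c (z, B x))\<close>, so a solution of the game is
  exactly a point \<open>x\<close> with \<open>B x\<close> in its own subdifferential.\<close>

lemma exists_self_subgradient: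
  fixes c :: "'a::topological_space \<times> 'b \<Rightarrow> real"
  assumes compact: "compact (UNIV :: 'a set)"
    and skew: "c_skew_symmetric c B"
    and lsc: "lower_semicont \<phi>"
    and conv: "unif_arcwise_convex_fst (\<lambda>(x, y). \<phi> x - c (x, y))"
    and usc: "\<And>y. upper_semicont (\<lambda>x. c (x, y))"
  shows "\<exists>x. B x \<in> c_subdifferential c \<phi> x"
proof -
  define M where "M x z = \<phi> x - c (x, B z) - (\<phi> z - c (z, B z))" for x z
  have skew': "c (x, B x) + c (z, B z) = c (x, B z) + c (z, B x)" for x z
    using skew unfolding c_skew_symmetric_def by blast
  have "\<exists>x. \<forall>z. M x z \<le> 0"
  proof (rule symmetric_game_solution[OF compact])
    show "lower_semicont (\<lambda>x. M x z)" for z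
    proof -
      have "{x. a < M x z} = {x. a + (\<phi> z - c (z, B z)) < \<phi> x - c (x, B z)}" for a
        by (auto simp: M_def)
      then show ?thesis
        using lower_semicont_diff[OF lsc usc[of "B z"]] by (simp add: lower_semicont_def)
    qed
    show "M x z = - M z x" for x z
      using skew'[of x z] by (simp add: M_def)
    fix x0 x1 :: 'a and t :: real
    assume t: "t \<in> {0..1}"
    then obtain w where w: "\<And>y. \<phi> w - c (w, y)
        \<le> (1 - t) * (\<phi> x0 - c (x0, y)) + t * (\<phi> x1 - c (x1, y))"
      using conv unfolding unif_arcwise_convex_fst_def by fastforce
    \<comment> \<open>The subtracted term \<open>\<phi> z - c (z, B z)\<close> is free of the first
      argument and the weights sum to 1, so convexity passes to \<open>M\<close>.\<close>
    have "M w z \<le> (1 - t) * M x0 z + t * M x1 z" for z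
      using w[of "B z"] by (simp add: M_def algebra_simps)
    then show "\<exists>w. \<forall>z. M w z \<le> (1 - t) * M x0 z + t * M x1 z"
      by blast
  qed
  then obtain x where x: "\<And>z. M x z \<le> 0"
    by blast
  have "\<phi> x - \<phi> z \<le> c (x, B x) - c (z, B x)" for z
    using x[of z] skew'[of x z] by (simp add: M_def)
  then show ?thesis
    by (auto simp: c_subdifferential_def)
qed

theorem theorem1p7:
  fixes c :: "'a::topological_space \<times> 'b::topological_space \<Rightarrow> real"
    and B :: "'a \<Rightarrow> 'b"
    and \<phi> :: "'a \<Rightarrow> real"
  assumes "compact (UNIV :: 'a set)"
    and "unif_arcwise_convex_snd c"
    and "c_skew_symmetric c B"
    and "lower_semicont \<phi>"
    and "unif_arcwise_convex_fst (\<lambda>(x, y). \<phi> x - c (x, y))"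
  shows "((\<forall>y. upper_semicont (\<lambda>x. c (x, y))) \<longrightarrow> (INF x. J_functional c B \<phi> x) = 0)
       \<and> (continuous_on UNIV B \<and> continuous_on UNIV c \<longrightarrow>
            (\<exists>x0. J_functional c B \<phi> x0 = (INF x. J_functional c B \<phi> x) \<and>
                  B x0 \<in> c_subdifferential c \<phi> x0))"
proof -
  \<comment> \<open>Both claims come from one point \<open>x0\<close>, found under upper
    semicontinuity of \<open>c\<close> in its first variable; for the second claim continuity of
    \<open>c\<close> supplies this.\<close>
  have attained: "\<exists>x0. J_functional c B \<phi> x0 = 0 \<and> (INF x. J_functional c B \<phi> x) = 0 \<and>
      B x0 \<in> c_subdifferential c \<phi> x0"
    if usc: "\<And>y. upper_semicont (\<lambda>x. c (x, y))"
  proof -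
    obtain x0 where x0: "B x0 \<in> c_subdifferential c \<phi> x0"
      using exists_self_subgradient[OF assms(1,3-5) usc] by blast
    then have J0: "J_functional c B \<phi> x0 = 0"
      by (intro antisym J_functional_le_0 J_functional_nonneg)
    have "(INF x. J_functional c B \<phi> x) \<le> J_functional c B \<phi> x0"
      by (rule INF_lower) simp
    then have "(INF x. J_functional c B \<phi> x) = 0"
      unfolding J0 by (intro antisym INF_greatest J_functional_nonneg)
    with x0 J0 show ?thesis
      by blast
  qed
  have usc: "upper_semicont (\<lambda>x. c (x, y))" if "continuous_on UNIV c" for y
  proof -
    have "continuous_on UNIV (\<lambda>x. c (x, y))"
      using that by (intro continuous_on_compose2[OF that] continuous_intros) auto
    then show ?thesis
      by (auto simp: upper_semicont_def intro: open_Collect_less)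
  qed
  show ?thesis
    using attained usc by metis
qed

end
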